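(* Let $T>0$ and let $h:[0,T]\to\mathbb{R}$ be càdlàg and injective. Then $h$ is of finite variation on $[0,T]$ if and only if its jumps are absolutely summable, i.e. $\sum_{0<s\le T}|h(s)-h(s-)|<\infty$.
   Context: Càdlàg means right-continuous with left limits; $h(s-)$ denotes the left limit of $h$ at $s$. *)

theory Defs
  imports "HOL-Analysis.Analysis"
begin

text \<open>A function on $[a,b]$ is represented by a total function \<open>h :: real \<Rightarrow> real\<close> whose values
  outside \<open>{a..b}\<close> are irrelevant: right limits are only taken at points of \<open>{a..<b}\<close> and left
  limits only at points of \<open>{a<..b}\<close>.\<close>

definition cadlag_on :: "real \<Rightarrow> real \<Rightarrow> (real \<Rightarrow> real) \<Rightarrow> bool" where
  "cadlag_on a b h \<longleftrightarrow>
     (\<forall>t\<in>{a..<b}. continuous (at_right t) h) \<and>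
     (\<forall>t\<in>{a<..b}. \<exists>l. (h \<longlongrightarrow> l) (at_left t))"

text \<open>\<open>Lim\<close> is a definite description, so this is only meaningful where the left limit exists.\<close>

definition left_limit :: "(real \<Rightarrow> real) \<Rightarrow> real \<Rightarrow> real" where
  "left_limit h s = Lim (at_left s) h"

text \<open>The points \<open>t 0, \<dots>, t n\<close> subdivide $[a,b]$; values \<open>t i\<close> with \<open>i > n\<close> play no role.\<close>

definition is_subdivision :: "real \<Rightarrow> real \<Rightarrow> nat \<Rightarrow> (nat \<Rightarrow> real) \<Rightarrow> bool" where
  "is_subdivision a b n t \<longleftrightarrow> t 0 = a \<and> t n = b \<and> (\<forall>i<n. t i < t (Suc i))"

definition total_variation :: "real \<Rightarrow> real \<Rightarrow> (real \<Rightarrow> real) \<Rightarrow> ennreal" where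
  "total_variation a b h =
     Sup {ennreal (\<Sum>i<n. \<bar>h (t (Suc i)) - h (t i)\<bar>) | n t. is_subdivision a b n t}"

definition finite_variation_on :: "real \<Rightarrow> real \<Rightarrow> (real \<Rightarrow> real) \<Rightarrow> bool" where
  "finite_variation_on a b h \<longleftrightarrow> total_variation a b h < \<infinity>"

end

theory Submission
  imports Defs
begin

text \<open>Summable jumps imply finite variation by a Banach indicatrix argument. If $y$ lies strictly
  between \<open>h (t i)\<close> and \<open>h (t (i + 1))\<close>, then at some $s \in (t_i, t_{i+1}]$ the value $y$
  lies in the closed interval spanned by $h(s-)$ and $h(s)$; if $h$ is continuous at $s$, then
  $y = h(s)$, and injectivity allows this for at most one $i$. Comparing Lebesgue measures, the
  variation along any subdivision is at most $2 \sup |h|$ plus the sum of all jumps. Conversely,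
  finitely many jumps are approximated by increments along a subdivision containing the jump times
  and points just to the left of them.\<close>

section \<open>Left limits and boundedness of cadlag functions\<close>

lemma cadlag_on_tendsto_left_limit:
  assumes "cadlag_on a b h" "a < s" "s \<le> b"
  shows "(h \<longlongrightarrow> left_limit h s) (at_left s)"
proof -
  obtain l where "(h \<longlongrightarrow> l) (at_left s)"
    using assms unfolding cadlag_on_def by (meson greaterThanAtMost_iff)
  then show ?thesis unfolding left_limit_def using tendsto_Lim[of "at_left s" h l] by simp
qed

text \<open>One-sided limits make \<open>h\<close> bounded near every point, and boundedness passes
  to the union of two adjoining intervals, so bisection gives a global bound.\<close>

lemma bounded_cadlag_on:
  assumes "a \<le> b" and "cadlag_on a b h"
  shows "bounded (h ` {a..b})"
proof -
  \<comment> \<open>The intersection with \<open>{a..b}\<close> matters because the small intervals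
    in the local condition of \<open>Bolzano\<close> may stick out of \<open>{a..b}\<close>, where
    nothing is known about \<open>h\<close>.\<close>
  let ?P = "\<lambda>u v. bounded (h ` ({u..v} \<inter> {a..b}))"
  have "?P a b"
  proof (rule Bolzano[of a b ?P, OF \<open>a \<le> b\<close>])
    fix u v w assume "?P u v" "?P v w" "u \<le> v" "v \<le> w"
    have "h ` ({u..w} \<inter> {a..b}) \<subseteq> h ` ({u..v} \<inter> {a..b}) \<union> h ` ({v..w} \<inter> {a..b})"
      by force
    then show "?P u w" using \<open>?P u v\<close> \<open>?P v w\<close> by (metis bounded_Un bounded_subset)
  next
    fix x assume x: "a \<le> x" "x \<le> b"
    \<comment> \<open>\<open>R\<close> and \<open>L\<close> leave out \<open>x\<close> itself, which
      is why \<open>\<bar>h x\<bar>\<close> enters the final maximum. At an end point without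
      neighbours on the given side the claim is vacuous and \<open>d = 1\<close> serves.\<close>
    have R: "\<exists>d>0. \<exists>B. \<forall>y. x < y \<and> y < x + d \<and> y \<le> b \<longrightarrow> \<bar>h y\<bar> \<le> B"
    proof (cases "x < b")
      case True
      then have "(h \<longlongrightarrow> h x) (at_right x)"
        using assms(2) x by (auto simp: cadlag_on_def continuous_within)
      then have "\<forall>\<^sub>F y in at_right x. dist (h y) (h x) < 1"
        by (rule tendstoD) simp
      then obtain c where c: "c > x" "\<And>y. x < y \<Longrightarrow> y < c \<Longrightarrow> dist (h y) (h x) < 1"
        by (auto simp: eventually_at_right_field)
      show ?thesis
      proof (intro exI conjI allI impI)
        show "c - x > 0" using c by simp
        fix y assume "x < y \<and> y < x + (c - x) \<and> y \<le> b"
        then show "\<bar>h y\<bar> \<le> \<bar>h x\<bar> + 1"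
          using c(2)[of y] by (auto simp: dist_real_def)
      qed
    qed (auto intro!: exI[of _ 1])
    have L: "\<exists>d>0. \<exists>B. \<forall>y. x - d < y \<and> y < x \<and> a \<le> y \<longrightarrow> \<bar>h y\<bar> \<le> B"
    proof (cases "a < x")
      case True
      let ?l = "left_limit h x"
      have "(h \<longlongrightarrow> ?l) (at_left x)"
        using cadlag_on_tendsto_left_limit[OF assms(2) True] x by simp
      then have "\<forall>\<^sub>F y in at_left x. dist (h y) ?l < 1"
        by (rule tendstoD) simp
      then obtain c where c: "c < x" "\<And>y. c < y \<Longrightarrow> y < x \<Longrightarrow> dist (h y) ?l < 1"
        by (auto simp: eventually_at_left_field)
      show ?thesis
      proof (intro exI conjI allI impI)
        show "x - c > 0" using c by simp
        fix y assume "x - (x - c) < y \<and> y < x \<and> a \<le> y"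
        then show "\<bar>h y\<bar> \<le> \<bar>?l\<bar> + 1"
          using c(2)[of y] by (auto simp: dist_real_def)
      qed
    qed (auto intro!: exI[of _ 1])
    from R obtain d B where d: "d > 0"
      and B: "\<And>y. x < y \<Longrightarrow> y < x + d \<Longrightarrow> y \<le> b \<Longrightarrow> \<bar>h y\<bar> \<le> B" by blast
    from L obtain d' B' where d': "d' > 0"
      and B': "\<And>y. x - d' < y \<Longrightarrow> y < x \<Longrightarrow> a \<le> y \<Longrightarrow> \<bar>h y\<bar> \<le> B'" by blast
    show "\<exists>e>0. \<forall>u v. u \<le> x \<and> x \<le> v \<and> v - u < e \<longrightarrow> ?P u v"
    proof (intro exI conjI allI impI)
      show "min d d' > 0" using d d' by simp
      fix u v assume uv: "u \<le> x \<and> x \<le> v \<and> v - u < min d d'"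
      have "\<bar>h y\<bar> \<le> max \<bar>h x\<bar> (max B B')" if "y \<in> {u..v} \<inter> {a..b}" for y
        using that uv B[of y] B'[of y] by (cases y x rule: linorder_cases) auto
      then show "?P u v" by (intro boundedI[of _ "max \<bar>h x\<bar> (max B B')"]) auto
    qed
  qed
  then show ?thesis by simp
qed

section \<open>Levels crossed between two points\<close>

text \<open>Take \<open>s\<close> to be the infimum of the points where \<open>h\<close> exceeds
  \<open>y\<close>. Before \<open>s\<close> the values are at most \<open>y\<close>, hence so is the
  left limit; right continuity excludes \<open>h s < y\<close>.\<close>

lemma cadlag_crossing_up:
  fixes h :: "real \<Rightarrow> real"
  assumes right: "\<And>s. u \<le> s \<Longrightarrow> s < v \<Longrightarrow> (h \<longlongrightarrow> h s) (at_right s)"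
    and left: "\<And>s. u < s \<Longrightarrow> s \<le> v \<Longrightarrow> (h \<longlongrightarrow> l s) (at_left s)"
    and "u < v" "h u < y" "y < h v"
  shows "\<exists>s\<in>{u<..v}. l s \<le> y \<and> y \<le> h s"
proof -
  define S where "S = {x\<in>{u..v}. y < h x}"
  define s where "s = Inf S"
  have S: "v \<in> S" "bdd_below S" using assms by (auto simp: S_def intro!: bdd_belowI)
  have us: "u \<le> s" unfolding s_def using S by (intro cInf_greatest) (auto simp: S_def)
  have sv: "s \<le> v" unfolding s_def using S by (intro cInf_lower)
  have below: "h x \<le> y" if "u \<le> x" "x < s" for x
    using that sv cInf_lower[OF _ S(2), of x] by (force simp: S_def s_def)
  have hs: "y \<le> h s"
  proof (rule ccontr)
    assume "\<not> y \<le> h s"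
    then have less: "h s < y" by simp
    with sv assms have "s < v" by (cases "s = v") auto
    from right[OF us this] less have "\<forall>\<^sub>F x in at_right s. h x < y"
      by (rule order_tendstoD)
    then obtain c where c: "s < c" "\<And>x. s < x \<Longrightarrow> x < c \<Longrightarrow> h x < y"
      by (auto simp: eventually_at_right_field)
    \<comment> \<open>No point of \<open>S\<close> lies in \<open>[s, c)\<close>, so
      \<open>c\<close> would be a lower bound of \<open>S\<close> beyond its infimum.\<close>
    have "c \<le> s" unfolding s_def
    proof (rule cInf_greatest)
      fix x assume x: "x \<in> S"
      then have "s \<le> x" using S(2) by (auto simp: s_def intro: cInf_lower)
      then show "c \<le> x" using c(2)[of x] x less by (cases "x = s") (force simp: S_def)+
    qed (use S in auto)
    with c(1) show False by simp
  qed
  \<comment> \<open>Since \<open>h u < y \<le> h s\<close>, the two points differ, and the left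
    limit at \<open>s\<close> is available.\<close>
  with assms us have "u < s" by (cases "u = s") auto
  have "\<forall>\<^sub>F x in at_left s. h x \<le> y"
    using \<open>u < s\<close> below by (auto simp: eventually_at_left_field intro!: exI[of _ u])
  with left[OF \<open>u < s\<close> sv] have "l s \<le> y"
    by (intro tendsto_upperbound) auto
  with hs \<open>u < s\<close> sv show ?thesis by auto
qed

text \<open>A downward crossing by \<open>h\<close> is an upward one by \<open>-h\<close> at level
  \<open>-y\<close>. Keeping \<open>l\<close> an arbitrary family of left limits lets it be negated
  along with \<open>h\<close>.\<close>

lemma cadlag_crossing:
  fixes h :: "real \<Rightarrow> real"
  assumes right: "\<And>s. u \<le> s \<Longrightarrow> s < v \<Longrightarrow> (h \<longlongrightarrow> h s) (at_right s)"
    and left: "\<And>s. u < s \<Longrightarrow> s \<le> v \<Longrightarrow> (h \<longlongrightarrow> l s) (at_left s)"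
    and "u < v" "y \<in> {min (h u) (h v)<..<max (h u) (h v)}"
  shows "\<exists>s\<in>{u<..v}. y \<in> {min (l s) (h s)..max (l s) (h s)}"
proof (cases "h u < h v")
  case True
  have "\<exists>s\<in>{u<..v}. l s \<le> y \<and> y \<le> h s"
    using True assms(3,4) by (intro cadlag_crossing_up right left) auto
  then obtain s where s: "s \<in> {u<..v}" "l s \<le> y" "y \<le> h s" by auto
  then show ?thesis by (intro bexI[of _ s]) auto
next
  case False
  have "\<exists>s\<in>{u<..v}. - l s \<le> - y \<and> - y \<le> - h s"
    using False assms(3,4)
    by (intro cadlag_crossing_up tendsto_minus right left) auto
  then obtain s where s: "s \<in> {u<..v}" "h s \<le> y" "y \<le> l s" by auto
  then show ?thesis by (intro bexI[of _ s]) auto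
qed

section \<open>Countable subadditivity with an unordered sum\<close>

text \<open>Subadditivity is applied to a sequence, whereas \<open>infsum\<close> is unordered.
  Grouping \<open>S\<close> by \<open>to_nat_on\<close> links the two: the fibres are finite by
  injectivity, and empty fibres absorb the case of finite \<open>S\<close>.\<close>

lemma emeasure_UN_le_infsum:
  fixes f :: "'a \<Rightarrow> real"
  assumes "countable S"
    and meas: "\<And>s. s \<in> S \<Longrightarrow> A s \<in> sets M"
    and le: "\<And>s. s \<in> S \<Longrightarrow> emeasure M (A s) \<le> ennreal (f s)"
    and nonneg: "\<And>s. s \<in> S \<Longrightarrow> 0 \<le> f s"
    and summable: "f summable_on S"
  shows "emeasure M (\<Union>s\<in>S. A s) \<le> ennreal (infsum f S)"
proof -
  let ?J = "\<lambda>n. {s\<in>S. to_nat_on S s = n}"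
  define B where "B n = (\<Union>s\<in>?J n. A s)" for n
  have inj: "inj_on (to_nat_on S) S" using assms(1) by (rule inj_on_to_nat_on)
  have fin: "finite (?J n)" for n
    using finite_vimage_IntI[OF _ inj, of "{n}"] by (simp add: vimage_def Int_def conj_commute)
  have Bm: "B n \<in> sets M" for n
    unfolding B_def using meas by (intro sets.finite_UN fin) auto
  have Ble: "emeasure M (B n) \<le> (\<Sum>s\<in>?J n. ennreal (f s))" for n
  proof -
    have "emeasure M (B n) \<le> (\<Sum>s\<in>?J n. emeasure M (A s))"
      unfolding B_def using meas by (intro emeasure_subadditive_finite fin) auto
    also have "\<dots> \<le> (\<Sum>s\<in>?J n. ennreal (f s))" by (intro sum_mono le) auto
    finally show ?thesis .
  qed
  have "(\<Union>s\<in>S. A s) = (\<Union>n. B n)" by (auto simp: B_def)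
  then have "emeasure M (\<Union>s\<in>S. A s) \<le> (\<Sum>n. emeasure M (B n))"
    using Bm by (auto intro!: emeasure_subadditive_countably)
  also have "\<dots> \<le> ennreal (infsum f S)"
  proof (intro suminf_le_const)
    fix N
    \<comment> \<open>Each partial sum is controlled by the sum of \<open>f\<close> over the finite
      set \<open>?F \<subseteq> S\<close>, because distinct fibres are disjoint.\<close>
    let ?F = "\<Union>n\<in>{..<N}. ?J n"
    have "(\<Sum>n<N. emeasure M (B n)) \<le> (\<Sum>n<N. \<Sum>s\<in>?J n. ennreal (f s))"
      by (intro sum_mono Ble)
    also have "\<dots> = (\<Sum>s\<in>?F. ennreal (f s))"
      using fin by (intro sum.UNION_disjoint[symmetric]) auto
    also have "\<dots> = ennreal (\<Sum>s\<in>?F. f s)"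
      using nonneg by (intro sum_ennreal) auto
    also have "\<dots> \<le> ennreal (infsum f S)"
      using fin by (intro ennreal_leI finite_sum_le_infsum summable nonneg) auto
    finally show "(\<Sum>n<N. emeasure M (B n)) \<le> ennreal (infsum f S)" .
  qed simp
  finally show ?thesis .
qed

section \<open>Subdivisions\<close>

lemma is_subdivision_mono:
  assumes "is_subdivision a b n t" "i \<le> j" "j \<le> n"
  shows "t i \<le> t j"
  using assms(2,3)
proof (induction j rule: dec_induct)
  case (step k)
  then have "t i \<le> t k" "t k < t (Suc k)"
    using assms(1) by (auto simp: is_subdivision_def)
  then show ?case by simp
qed simp

lemma is_subdivision_append:
  assumes "is_subdivision a b n t" "b < c"
  shows "is_subdivision a c (Suc n) (t(Suc n := c))"
    and "(\<Sum>i<Suc n. \<bar>h ((t(Suc n := c)) (Suc i)) - h ((t(Suc n := c)) i)\<bar>)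
      = (\<Sum>i<n. \<bar>h (t (Suc i)) - h (t i)\<bar>) + \<bar>h c - h b\<bar>"
  using assms by (auto simp: is_subdivision_def less_Suc_eq)

text \<open>The half-open pieces tile \<open>{a<..t k}\<close>, so a subdivision point is counted
  only in the piece that it closes. Stating this for every prefix \<open>k \<le> n\<close> allows
  induction on \<open>k\<close> with the subdivision fixed.\<close>

lemma infsum_subdivision:
  fixes f :: "real \<Rightarrow> real"
  assumes "is_subdivision a b n t" "f summable_on {a<..b}" "k \<le> n"
  shows "(\<Sum>i<k. infsum f {t i<..t (Suc i)}) = infsum f {a<..t k}"
  using \<open>k \<le> n\<close>
proof (induction k)
  case 0
  then show ?case using assms(1) by (simp add: is_subdivision_def)
next
  case (Suc k)
  have t: "t 0 = a" "t n = b" using assms(1) by (auto simp: is_subdivision_def)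
  have ord: "a \<le> t k" "t k \<le> t (Suc k)" "t (Suc k) \<le> b"
    using Suc.prems is_subdivision_mono[OF assms(1), of 0 k]
      is_subdivision_mono[OF assms(1), of k "Suc k"]
      is_subdivision_mono[OF assms(1), of "Suc k" n] t by auto
  have "infsum f {a<..t (Suc k)} = infsum f ({a<..t k} \<union> {t k<..t (Suc k)})"
    using ord by (intro arg_cong[of _ _ "infsum f"]) auto
  also have "\<dots> = infsum f {a<..t k} + infsum f {t k<..t (Suc k)}"
    using ord by (intro infsum_Un_disjoint summable_on_subset_banach[OF assms(2)]) auto
  finally show ?case using Suc by simp
qed

section \<open>Variation bounded by the range and the jumps\<close>

lemma variation_le_bound_plus_jumps:
  fixes h :: "real \<Rightarrow> real"
  assumes cadlag: "cadlag_on a b h" and inj: "inj_on h {a..b}"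
    and summable: "(\<lambda>s. \<bar>h s - left_limit h s\<bar>) summable_on {a<..b}"
    and bound: "\<And>x. x \<in> {a..b} \<Longrightarrow> \<bar>h x\<bar> \<le> B"
    and sub: "is_subdivision a b n t"
  shows "(\<Sum>i<n. \<bar>h (t (Suc i)) - h (t i)\<bar>)
    \<le> 2 * B + (\<Sum>\<^sub>\<infinity>s\<in>{a<..b}. \<bar>h s - left_limit h s\<bar>)"
proof -
  define l where "l = left_limit h"
  define f where "f s = \<bar>h s - l s\<bar>" for s
  \<comment> \<open>Only true jumps may contribute to \<open>U i\<close>: where
    \<open>f s = 0\<close> the interval \<open>I s\<close> shrinks to the point \<open>h s\<close>,
    and uncountably many such points could have positive measure.\<close>
  define D where "D = {s\<in>{a<..b}. f s \<noteq> 0}"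
  define G where "G i = {t i<..t (Suc i)}" for i
  define I where "I s = {min (l s) (h s)..max (l s) (h s)}" for s
  define U where "U i = (\<Union>s\<in>D \<inter> G i. I s)" for i
  define E where "E i = {min (h (t i)) (h (t (Suc i)))<..<max (h (t i)) (h (t (Suc i)))}" for i
  \<comment> \<open>\<open>A i\<close> keeps the levels of \<open>E i\<close> that no jump in the
    piece \<open>G i\<close> covers. Its measure is charged to the range of \<open>h\<close>, that
    of \<open>U i\<close> to the jumps.\<close>
  define A where "A i = E i - U i" for i
  have summ: "f summable_on {a<..b}" using summable by (simp add: f_def[abs_def] l_def)
  have t: "t 0 = a" "t n = b" and step: "\<And>i. i < n \<Longrightarrow> t i < t (Suc i)"
    using sub by (auto simp: is_subdivision_def)
  have ord: "a \<le> t i" "t i \<le> b" if "i \<le> n" for i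
    using is_subdivision_mono[OF sub, of 0 i] is_subdivision_mono[OF sub, of i n] that t by auto
  have Gsub: "G i \<subseteq> {a<..b}" if "i < n" for i
    using ord[of i] ord[of "Suc i"] that by (auto simp: G_def)
  have "a \<le> b" using ord[of 0] t by simp
  have "B \<ge> 0" using bound[of a] \<open>a \<le> b\<close> by auto
  \<comment> \<open>A summable real family has only countably many nonzero terms; hence
    \<open>U i\<close> is a countable union of intervals and measurable.\<close>
  have countD: "countable D" unfolding D_def
    using summable_countable_real[OF summ] by (simp add: conj_commute)
  have Um: "U i \<in> sets lborel" for i
    unfolding U_def using countD by (intro sets.countable_UN') (auto simp: I_def)
  have Em: "E i \<in> sets lborel" for i by (simp add: E_def)
  have Am: "A i \<in> sets lborel" for i using Um Em by (auto simp: A_def)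
  have summG: "f summable_on G i" if "i < n" for i
    by (rule summable_on_subset_banach[OF summ Gsub[OF that]])
  have emU: "emeasure lborel (U i) \<le> ennreal (infsum f (G i))" if "i < n" for i
  proof -
    have summDG: "f summable_on (D \<inter> G i)"
      by (rule summable_on_subset_banach[OF summG[OF that]]) simp
    have "emeasure lborel (U i) \<le> ennreal (infsum f (D \<inter> G i))"
      unfolding U_def
    proof (rule emeasure_UN_le_infsum)
      show "countable (D \<inter> G i)" using countD by simp
      show "emeasure lborel (I s) \<le> ennreal (f s)" for s
        by (auto simp: I_def f_def min_def max_def abs_if)
    qed (use summDG in \<open>auto simp: I_def f_def\<close>)
    also have "\<dots> \<le> ennreal (infsum f (G i))"
      by (intro ennreal_leI infsum_mono_neutral summDG summG that) (auto simp: f_def)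
    finally show ?thesis .
  qed
  have emE: "ennreal \<bar>h (t (Suc i)) - h (t i)\<bar> \<le> emeasure lborel (A i) + ennreal (infsum f (G i))"
    if "i < n" for i
  proof -
    have "ennreal \<bar>h (t (Suc i)) - h (t i)\<bar> = emeasure lborel (E i)"
      by (auto simp: E_def min_def max_def abs_if)
    also have "\<dots> \<le> emeasure lborel (A i \<union> U i)"
      using Am Um by (intro emeasure_mono sets.Un) (auto simp: A_def)
    also have "\<dots> \<le> emeasure lborel (A i) + emeasure lborel (U i)"
      using Am Um by (intro emeasure_subadditive) auto
    also have "\<dots> \<le> emeasure lborel (A i) + ennreal (infsum f (G i))"
      using emU[OF that] by (intro add_left_mono)
    finally show ?thesis .
  qed
  have Aim: "A i \<subseteq> h ` G i" if "i < n" for i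
  proof
    fix y assume y: "y \<in> A i"
    have "\<exists>s\<in>{t i<..t (Suc i)}. y \<in> {min (l s) (h s)..max (l s) (h s)}"
    proof (rule cadlag_crossing)
      show "(h \<longlongrightarrow> h s) (at_right s)" if "t i \<le> s" "s < t (Suc i)" for s
        using cadlag that ord[of i] ord[of "Suc i"] \<open>i < n\<close>
        by (auto simp: cadlag_on_def continuous_within)
      show "(h \<longlongrightarrow> l s) (at_left s)" if "t i < s" "s \<le> t (Suc i)" for s
        unfolding l_def using that ord[of i] ord[of "Suc i"] \<open>i < n\<close>
        by (intro cadlag_on_tendsto_left_limit[OF cadlag]) auto
      show "t i < t (Suc i)" using step that by simp
      show "y \<in> {min (h (t i)) (h (t (Suc i)))<..<max (h (t i)) (h (t (Suc i)))}"
        using y by (simp add: A_def E_def)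
    qed
    then obtain s where s: "s \<in> G i" "y \<in> I s" by (auto simp: G_def I_def)
    \<comment> \<open>As \<open>y\<close> lies outside \<open>U i\<close>, the crossing point
      \<open>s\<close> is not a jump, and \<open>I s\<close> is the single point
      \<open>h s\<close>.\<close>
    with y have "s \<notin> D" by (auto simp: A_def U_def)
    with s Gsub[OF that] have "f s = 0" by (auto simp: D_def)
    with s have "y = h s" by (simp add: I_def f_def)
    with s show "y \<in> h ` G i" by blast
  qed
  have Gdisj: "G i \<inter> G j = {}" if "i < j" "j < n" for i j
    using is_subdivision_mono[OF sub, of "Suc i" j] that by (auto simp: G_def)
  have Adisj: "A i \<inter> A j = {}" if "i < j" "j < n" for i j
  proof -
    \<comment> \<open>The only use of injectivity: disjoint pieces have disjoint images, so an
      uncovered level belongs to at most one \<open>A i\<close>.\<close>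
    have "h ` G i \<inter> h ` G j = h ` (G i \<inter> G j)"
      using Gsub[of i] Gsub[of j] that
      by (intro inj_on_image_Int[OF inj, symmetric]) force+
    then show ?thesis using Aim[of i] Aim[of j] Gdisj[of i j] that by auto
  qed
  have disj: "disjoint_family_on A {..<n}"
    unfolding disjoint_family_on_def
    by (metis Adisj Int_commute lessThan_iff linorder_neq_iff)
  \<comment> \<open>The disjoint sets \<open>A i\<close> all lie in the range of \<open>h\<close>,
    so their total measure is at most \<open>2 * B\<close>, however many pieces there are.\<close>
  have "(\<Sum>i<n. emeasure lborel (A i)) = emeasure lborel (\<Union>i<n. A i)"
    using Am disj by (intro sum_emeasure) auto
  also have "\<dots> \<le> emeasure lborel {-B..B}"
  proof (intro emeasure_mono UN_least)
    fix i assume "i \<in> {..<n}"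
    then have i: "i < n" by simp
    show "A i \<subseteq> {-B..B}"
    proof
      fix y assume "y \<in> A i"
      with Aim[OF i] obtain x where "x \<in> G i" "y = h x" by blast
      moreover from this Gsub[OF i] have "x \<in> {a..b}" by fastforce
      ultimately show "y \<in> {-B..B}" using bound[of x] by (auto simp: abs_le_iff)
    qed
  qed simp
  also have "\<dots> = ennreal (2 * B)" using \<open>B \<ge> 0\<close> by simp
  finally have sumA: "(\<Sum>i<n. emeasure lborel (A i)) \<le> ennreal (2 * B)" .
  have nn: "0 \<le> infsum f S" for S by (intro infsum_nonneg) (simp add: f_def)
  have "ennreal (\<Sum>i<n. \<bar>h (t (Suc i)) - h (t i)\<bar>)
      = (\<Sum>i<n. ennreal \<bar>h (t (Suc i)) - h (t i)\<bar>)" by (simp add: sum_ennreal)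
  also have "\<dots> \<le> (\<Sum>i<n. emeasure lborel (A i) + ennreal (infsum f (G i)))"
    by (intro sum_mono emE) simp
  also have "\<dots> = (\<Sum>i<n. emeasure lborel (A i)) + ennreal (\<Sum>i<n. infsum f (G i))"
    using nn by (simp add: sum.distrib sum_ennreal)
  also have "(\<Sum>i<n. infsum f (G i)) = infsum f {a<..b}"
    using infsum_subdivision[OF sub summ, of n] t by (simp add: G_def)
  also have "(\<Sum>i<n. emeasure lborel (A i)) + ennreal (infsum f {a<..b})
      \<le> ennreal (2 * B) + ennreal (infsum f {a<..b})"
    by (intro add_right_mono sumA)
  also have "\<dots> = ennreal (2 * B + infsum f {a<..b})"
    using nn \<open>B \<ge> 0\<close> by (intro ennreal_plus[symmetric]) auto
  finally have "(\<Sum>i<n. \<bar>h (t (Suc i)) - h (t i)\<bar>) \<le> 2 * B + infsum f {a<..b}"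
    using nn \<open>B \<ge> 0\<close> by (subst (asm) ennreal_le_iff) auto
  then show ?thesis by (simp add: f_def[abs_def] l_def)
qed

section \<open>Jumps bounded by the variation\<close>

text \<open>The induction splits off the largest jump time \<open>s\<close>. Both \<open>b\<close>
  and \<open>\<epsilon>\<close> are generalized because the induction hypothesis is used on
  \<open>[a, u]\<close> with \<open>u\<close> just left of \<open>s\<close>, and with half the
  error.\<close>

lemma jumps_le_variation_plus:
  fixes h l :: "real \<Rightarrow> real"
  assumes "finite F" "F \<subseteq> {a<..b}" "a < b" "\<epsilon> > 0"
    and "\<And>s. s \<in> F \<Longrightarrow> (h \<longlongrightarrow> l s) (at_left s)"
  shows "\<exists>n t. is_subdivision a b n t \<and>
    (\<Sum>s\<in>F. \<bar>h s - l s\<bar>) \<le> (\<Sum>i<n. \<bar>h (t (Suc i)) - h (t i)\<bar>) + \<epsilon>"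
  using assms
proof (induction F arbitrary: b \<epsilon> rule: finite_linorder_max_induct)
  case empty
  have "is_subdivision a b 1 (\<lambda>i. if i = 0 then a else b)"
    using empty by (simp add: is_subdivision_def)
  moreover have "(\<Sum>s\<in>{}. \<bar>h s - l s\<bar>) \<le>
      (\<Sum>i<1. \<bar>h (if Suc i = 0 then a else b) - h (if i = 0 then a else b)\<bar>) + \<epsilon>"
    using empty by simp
  ultimately show ?case by blast
next
  case (insert s F)
  have s: "a < s" "s \<le> b" using insert.prems by auto
  \<comment> \<open>Any \<open>u\<close> in \<open>(m, s)\<close> lies beyond all earlier jump
    times. Inserting \<open>a\<close> covers the case of empty \<open>F\<close> and ensures
    \<open>a < u\<close>.\<close>
  define m where "m = Max (insert a F)"
  have m: "a \<le> m" "F \<subseteq> {..m}" "m < s"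
    using insert.hyps s by (auto simp: m_def)
  have "\<forall>\<^sub>F u in at_left s. dist (h u) (l s) < \<epsilon> / 2"
    using insert.prems by (intro tendstoD) auto
  moreover have "\<forall>\<^sub>F u in at_left s. u \<in> {m<..<s}"
    using m by (intro eventually_at_left_real)
  ultimately have "\<forall>\<^sub>F u in at_left s. dist (h u) (l s) < \<epsilon> / 2 \<and> u \<in> {m<..<s}"
    by (rule eventually_conj)
  then obtain u where u: "dist (h u) (l s) < \<epsilon> / 2" "m < u" "u < s"
    using eventually_happens[of _ "at_left s"] by auto
  have "F \<subseteq> {a<..u}" using insert.prems(1) m u by fastforce
  then have "\<exists>n t. is_subdivision a u n t \<and>
      (\<Sum>s\<in>F. \<bar>h s - l s\<bar>) \<le> (\<Sum>i<n. \<bar>h (t (Suc i)) - h (t i)\<bar>) + \<epsilon> / 2"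
    using insert.prems m u by (intro insert.IH) auto
  then obtain n t where nt: "is_subdivision a u n t"
    and le: "(\<Sum>s\<in>F. \<bar>h s - l s\<bar>) \<le> (\<Sum>i<n. \<bar>h (t (Suc i)) - h (t i)\<bar>) + \<epsilon> / 2" by blast
  let ?t = "t(Suc n := s)"
  note app = is_subdivision_append[OF nt \<open>u < s\<close>]
  have "s \<notin> F" using insert.hyps by auto
  then have "(\<Sum>s\<in>insert s F. \<bar>h s - l s\<bar>) = \<bar>h s - l s\<bar> + (\<Sum>s\<in>F. \<bar>h s - l s\<bar>)"
    using insert.hyps by simp
  \<comment> \<open>One half of \<open>\<epsilon>\<close> comes from the induction hypothesis, the
    other from replacing \<open>l s\<close> by \<open>h u\<close>.\<close>
  also have "\<dots> \<le> (\<Sum>i<Suc n. \<bar>h (?t (Suc i)) - h (?t i)\<bar>) + \<epsilon>"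
    unfolding app(2) using le u(1) unfolding dist_real_def by linarith
  finally have le': "(\<Sum>s\<in>insert s F. \<bar>h s - l s\<bar>)
    \<le> (\<Sum>i<Suc n. \<bar>h (?t (Suc i)) - h (?t i)\<bar>) + \<epsilon>" .
  show ?case
  \<comment> \<open>The subdivision built so far ends at \<open>s\<close>. If \<open>s < b\<close>,
    appending \<open>b\<close> adds one nonnegative term, so the estimate persists.\<close>
  proof (cases "s = b")
    case True
    with app(1) le' show ?thesis by blast
  next
    case False
    with s have "s < b" by simp
    note app' = is_subdivision_append[OF app(1) this]
    have "(\<Sum>s\<in>insert s F. \<bar>h s - l s\<bar>)
      \<le> (\<Sum>i<Suc (Suc n). \<bar>h ((?t(Suc (Suc n) := b)) (Suc i)) - h ((?t(Suc (Suc n) := b)) i)\<bar>) + \<epsilon>"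
      unfolding app'(2) using le' by linarith
    with app'(1) show ?thesis by blast
  qed
qed

section \<open>The equivalence\<close>

theorem theorem4p4:
  fixes T :: real and h :: "real \<Rightarrow> real"
  assumes "T > 0"
    and "cadlag_on 0 T h"
    and "inj_on h {0..T}"
  shows "finite_variation_on 0 T h \<longleftrightarrow>
    (\<lambda>s. \<bar>h s - left_limit h s\<bar>) summable_on {0<..T}"
proof
  assume fv: "finite_variation_on 0 T h"
  \<comment> \<open>The total variation is finite here, so \<open>enn2real\<close> loses nothing and
    \<open>V\<close> bounds every variation sum as a real number.\<close>
  define V where "V = enn2real (total_variation 0 T h)"
  have V: "total_variation 0 T h = ennreal V"
    using fv by (simp add: V_def finite_variation_on_def)
  have var: "(\<Sum>i<n. \<bar>h (t (Suc i)) - h (t i)\<bar>) \<le> V" if "is_subdivision 0 T n t" for n t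
  proof -
    have "ennreal (\<Sum>i<n. \<bar>h (t (Suc i)) - h (t i)\<bar>) \<le> ennreal V"
      unfolding V[symmetric] total_variation_def using that by (intro Sup_upper) blast
    then show ?thesis by (subst (asm) ennreal_le_iff) (simp_all add: V_def)
  qed
  show "(\<lambda>s. \<bar>h s - left_limit h s\<bar>) summable_on {0<..T}"
  proof (rule nonneg_bdd_above_summable_on)
    show "bdd_above (sum (\<lambda>s. \<bar>h s - left_limit h s\<bar>) ` {F. F \<subseteq> {0<..T} \<and> finite F})"
    proof (intro bdd_aboveI2)
      fix F assume "F \<in> {F. F \<subseteq> {0<..T} \<and> finite F}"
      then have F: "finite F" "F \<subseteq> {0<..T}" by auto
      \<comment> \<open>Nonnegative terms are summable once their finite sums are uniformly bounded,
        so the fixed error \<open>1\<close> is good enough.\<close>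
      have "\<exists>n t. is_subdivision 0 T n t \<and> (\<Sum>s\<in>F. \<bar>h s - left_limit h s\<bar>)
          \<le> (\<Sum>i<n. \<bar>h (t (Suc i)) - h (t i)\<bar>) + 1"
        using F assms
        by (intro jumps_le_variation_plus cadlag_on_tendsto_left_limit[OF assms(2)]) auto
      with var show "(\<Sum>s\<in>F. \<bar>h s - left_limit h s\<bar>) \<le> V + 1" by fastforce
    qed
  qed simp
next
  assume summable: "(\<lambda>s. \<bar>h s - left_limit h s\<bar>) summable_on {0<..T}"
  obtain B where B: "\<And>x. x \<in> {0..T} \<Longrightarrow> \<bar>h x\<bar> \<le> B"
    using bounded_cadlag_on[of 0 T h] assms by (force simp: bounded_iff)
  \<comment> \<open>The bound is the same for all subdivisions and therefore passes to the
    supremum.\<close>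
  have "total_variation 0 T h
      \<le> ennreal (2 * B + (\<Sum>\<^sub>\<infinity>s\<in>{0<..T}. \<bar>h s - left_limit h s\<bar>))"
    unfolding total_variation_def
    using variation_le_bound_plus_jumps[OF assms(2,3) summable B]
    by (intro Sup_least) (auto intro!: ennreal_leI)
  then show "finite_variation_on 0 T h"
    unfolding finite_variation_on_def by (simp add: order_le_less_trans)
qed

end
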